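(* Let $\mathcal{X}\in\mathbb{R}^{s_1\times s_2\times s_3}$, let $A^{(l)}=A_p^{(l)}+dA^{(l)}\in\mathbb{R}^{s_l\times R}$, $l\in\{1,2,3\}$, be the current CP factor matrices, where $A_p^{(l)}$ are the factor matrices at the time the pairwise perturbation operators were formed, and let $\delta A^{(3)}=A^{(3)}_{\mathrm{new}}-A^{(3)}$ be the change of the third factor matrix performed by a regular ALS sweep. Let $k\in\{1,\ldots,R\}$ and suppose $\|da_k^{(l)}\|_2/\|a_k^{(l)}\|_2\le\epsilon<1$ for all $l\in\{1,2,3\}$. Let $\hat T=\mathcal{X}\times_3\delta a_k^{(3)T}\in\mathbb{R}^{s_1\times s_2}$. Then the update computed by pairwise perturbation without second order corrections satisfies $$\big\|\tilde h_k^{(1,3)}-h_k^{(1,3)}\big\|_2\le \|\hat T\|_2\,\|a_k^{(2)}\|_2\,\epsilon .$$ Further, since $h_k^{(1,3)}=\hat T a_k^{(2)}$, the relative error (when defined, i.e. $h_k^{(1,3)}\neq 0$) satisfies $$\frac{\|\tilde h_k^{(1,3)}-h_k^{(1,3)}\|_2}{\|h_k^{(1,3)}\|_2}\le\kappa(\hat T)\,\epsilon .$$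
   Context: Lower-case $a_k^{(l)}, da_k^{(l)},\delta a_k^{(l)}$ denote the $k$-th columns of $A^{(l)},dA^{(l)},\delta A^{(l)}$. $\mathcal{X}\times_3 v^T$ is the contraction of $\mathcal{X}$ with $v$ along mode 3, i.e. the matrix $(x,y)\mapsto\sum_z\mathcal{X}(x,y,z)v(z)$. CP-ALS: a regular update of the $n$-th factor is $A^{(n)}_{\mathrm{new}}=M^{(n)}\Gamma^{(n)\dagger}$, where $M^{(n)}$ has $k$-th column equal to the contraction of $\mathcal{X}$ with $a_k^{(j)}$ along every mode $j\neq n$, $\Gamma^{(n)}$ is the Hadamard product of $A^{(j)T}A^{(j)}$ over $j\ne n$, and $\dagger$ is the pseudoinverse. Let $\mathcal{M}^{(1,3)}(x,y,k)=\sum_{w}\mathcal{X}(x,w,y)A^{(2)}(w,k)$ and $\mathcal{M}_p^{(1,3)}(x,y,k)=\sum_{w}\mathcal{X}(x,w,y)A_p^{(2)}(w,k)$. The exact ALS update to the first-mode MTTKRP due to $\delta A^{(3)}$ is $h_k^{(1,3)}(x)=\sum_{y}\mathcal{M}^{(1,3)}(x,y,k)\,\delta A^{(3)}(y,k)$, and the pairwise perturbation update (without second order corrections) is $\tilde h_k^{(1,3)}(x)=\sum_{y}\mathcal{M}_p^{(1,3)}(x,y,k)\,\delta A^{(3)}(y,k)$. For a matrix $B$, $\|B\|_2$ is the spectral norm, and $\kappa(B)=\sup_{x\ne0}\frac{\|Bx\|_2}{\|x\|_2}\Big/\inf_{x\neq0}\frac{\|Bx\|_2}{\|x\|_2}$,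 with $\kappa(B)=+\infty$ if the infimum is $0$ (in particular if $B$ has more columns than rows). *)

theory Defs
  imports "HOL-Analysis.Analysis"
begin

type_synonym ('a, 'b, 'c) tensor3 = "real ^ 'c ^ 'b ^ 'a"

text \<open>A factor matrix with \<open>R = CARD('r)\<close> columns is a \<^typ>\<open>real^'r^'s\<close>, with rows indexed by
  \<^typ>\<open>'s\<close>.\<close>

type_synonym ('a, 'b, 'c, 'r) factors = "(real ^ 'r ^ 'a) \<times> (real ^ 'r ^ 'b) \<times> (real ^ 'r ^ 'c)"

definition contract3 :: "('a::finite, 'b::finite, 'c::finite) tensor3 \<Rightarrow> real ^ 'c \<Rightarrow> real ^ 'b ^ 'a"
  where "contract3 X v = (\<chi> x y. \<Sum>z\<in>UNIV. X $ x $ y $ z * v $ z)"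

text \<open>Moore--Penrose pseudoinverse, as the unique solution of the four Penrose equations.\<close>

definition pseudoinverse :: "real ^ 'n::finite ^ 'm::finite \<Rightarrow> real ^ 'm ^ 'n"
  where "pseudoinverse A = (THE P. A ** P ** A = A \<and> P ** A ** P = P \<and>
           transpose (A ** P) = A ** P \<and> transpose (P ** A) = P ** A)"

definition hadamard :: "real ^ 'n::finite ^ 'm::finite \<Rightarrow> real ^ 'n ^ 'm \<Rightarrow> real ^ 'n ^ 'm"
  where "hadamard A B = (\<chi> i j. A $ i $ j * B $ i $ j)"

definition mttkrp1 :: "('a::finite, 'b::finite, 'c::finite) tensor3 \<Rightarrow>
    real ^ 'r::finite ^ 'b \<Rightarrow> real ^ 'r ^ 'c \<Rightarrow> real ^ 'r ^ 'a"
  where "mttkrp1 X A2 A3 = (\<chi> x k. \<Sum>y\<in>UNIV. \<Sum>z\<in>UNIV. X $ x $ y $ z * A2 $ y $ k * A3 $ z $ k)"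

definition mttkrp2 :: "('a::finite, 'b::finite, 'c::finite) tensor3 \<Rightarrow>
    real ^ 'r::finite ^ 'a \<Rightarrow> real ^ 'r ^ 'c \<Rightarrow> real ^ 'r ^ 'b"
  where "mttkrp2 X A1 A3 = (\<chi> y k. \<Sum>x\<in>UNIV. \<Sum>z\<in>UNIV. X $ x $ y $ z * A1 $ x $ k * A3 $ z $ k)"

definition mttkrp3 :: "('a::finite, 'b::finite, 'c::finite) tensor3 \<Rightarrow>
    real ^ 'r::finite ^ 'a \<Rightarrow> real ^ 'r ^ 'b \<Rightarrow> real ^ 'r ^ 'c"
  where "mttkrp3 X A1 A2 = (\<chi> z k. \<Sum>x\<in>UNIV. \<Sum>y\<in>UNIV. X $ x $ y $ z * A1 $ x $ k * A2 $ y $ k)"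

definition gram_hadamard :: "real ^ 'r::finite ^ 'm::finite \<Rightarrow> real ^ 'r ^ 'n::finite \<Rightarrow> real ^ 'r ^ 'r"
  where "gram_hadamard A B = hadamard (transpose A ** A) (transpose B ** B)"

datatype mode = Mode1 | Mode2 | Mode3

fun als_update :: "('a::finite, 'b::finite, 'c::finite) tensor3 \<Rightarrow> mode \<Rightarrow>
    ('a, 'b, 'c, 'r::finite) factors \<Rightarrow> ('a, 'b, 'c, 'r) factors"
  where
    "als_update X Mode1 (A1, A2, A3) = (mttkrp1 X A2 A3 ** pseudoinverse (gram_hadamard A2 A3), A2, A3)"
  | "als_update X Mode2 (A1, A2, A3) = (A1, mttkrp2 X A1 A3 ** pseudoinverse (gram_hadamard A1 A3), A3)"
  | "als_update X Mode3 (A1, A2, A3) = (A1, A2, mttkrp3 X A1 A2 ** pseudoinverse (gram_hadamard A1 A2))"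

text \<open>A sweep updates each factor exactly once, each update using the factors as already updated
  in this sweep. The order of the modes is left open.\<close>

definition als_sweep :: "('a::finite, 'b::finite, 'c::finite) tensor3 \<Rightarrow>
    ('a, 'b, 'c, 'r::finite) factors \<Rightarrow> ('a, 'b, 'c, 'r) factors \<Rightarrow> bool"
  where "als_sweep X F F' \<longleftrightarrow>
           (\<exists>ms. distinct ms \<and> set ms = UNIV \<and> F' = fold (als_update X) ms F)"

text \<open>Given the current second factor, \<open>pp_operator13\<close> is \<open>\<M>\<^sup>(\<^sup>1\<^sup>,\<^sup>3\<^sup>)\<close>; given the factor at the time
  the operators were formed, it is \<open>\<M>\<^sub>p\<^sup>(\<^sup>1\<^sup>,\<^sup>3\<^sup>)\<close>. Likewise \<open>mttkrp_update13\<close> is \<open>h\<close> for the former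
  operator and \<open>h\<close> with a tilde for the latter.\<close>

definition pp_operator13 :: "('a::finite, 'b::finite, 'c::finite) tensor3 \<Rightarrow>
    real ^ 'r::finite ^ 'b \<Rightarrow> ('a, 'c, 'r) tensor3"
  where "pp_operator13 X A2 = (\<chi> x y k. \<Sum>w\<in>UNIV. X $ x $ w $ y * A2 $ w $ k)"

definition mttkrp_update13 :: "('a::finite, 'c::finite, 'r::finite) tensor3 \<Rightarrow>
    real ^ 'r ^ 'c \<Rightarrow> 'r \<Rightarrow> real ^ 'a"
  where "mttkrp_update13 M \<delta>A3 k = (\<chi> x. \<Sum>y\<in>UNIV. M $ x $ y $ k * \<delta>A3 $ y $ k)"

definition spectral_norm :: "real ^ 'n::finite ^ 'm::finite \<Rightarrow> real"
  where "spectral_norm B = onorm (\<lambda>x. B *v x)"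

text \<open>The case distinction is needed for the zero matrix: \<open>0 / 0 = 0\<close> in \<^typ>\<open>ereal\<close>.\<close>

definition cond_number :: "real ^ 'n::finite ^ 'm::finite \<Rightarrow> ereal"
  where "cond_number B =
    (let smax = (SUP x\<in>{x. x \<noteq> 0}. ereal (norm (B *v x) / norm x));
         smin = (INF x\<in>{x. x \<noteq> 0}. ereal (norm (B *v x) / norm x))
     in if smin = 0 then \<infinity> else smax / smin)"

end

theory Submission
  imports Defs
begin

text \<open>The exact and the perturbed update are both values of the same linear map \<open>T\<close>, at the current
  and at the old column of the second factor. Their difference is therefore \<open>T\<close> applied to
  \<open>- da\<^sub>k\<^sup>(\<^sup>2\<^sup>)\<close>, and both bounds express how far \<open>T\<close> can stretch one vector, absolutely or relative
  to another.\<close>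

text \<open>Contractions along different modes commute: the left side contracts mode 2 first and
  then mode 3, the right side does so in the opposite order.\<close>

lemma mttkrp_update13_pp_operator13:
  "mttkrp_update13 (pp_operator13 X A) D k = contract3 X (column k D) *v column k A"
proof -
  have "(\<Sum>y\<in>UNIV. (\<Sum>w\<in>UNIV. X $ x $ w $ y * A $ w $ k) * D $ y $ k)
      = (\<Sum>w\<in>UNIV. (\<Sum>y\<in>UNIV. X $ x $ w $ y * D $ y $ k) * A $ w $ k)" for x
    unfolding sum_distrib_right by (subst sum.swap) (simp only: mult_ac)
  then show ?thesis
    by (simp add: vec_eq_iff mttkrp_update13_def pp_operator13_def contract3_def
        matrix_vector_mult_def column_def)
qed

lemma column_diff: "column k (A - B) = column k A - column k (B :: real ^ 'n ^ 'm)"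
  by (simp add: column_def vec_eq_iff)

lemma norm_mult_le_spectral_norm: "norm (B *v x) \<le> spectral_norm B * norm x"
  unfolding spectral_norm_def by (rule onorm) (rule matrix_vector_mul_bounded_linear)

lemma spectral_norm_nonneg: "0 \<le> spectral_norm B"
  unfolding spectral_norm_def by (rule onorm_pos_le) (rule matrix_vector_mul_bounded_linear)

text \<open>The numerator is at most the largest stretching factor of \<open>B\<close> times
  \<open>norm y\<close>, the denominator at least the smallest one times \<open>norm x\<close>. This
  becomes the relative error bound once \<open>y\<close> is a perturbation of
  \<open>x\<close>.\<close>

lemma norm_quotient_le_cond_number:
  fixes B :: "real ^ 'n::finite ^ 'm::finite"
  assumes Bx: "B *v x \<noteq> 0" and y: "norm y \<le> e * norm x"
  shows "ereal (norm (B *v y) / norm (B *v x)) \<le> cond_number B * ereal e"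
proof -
  let ?r = "\<lambda>z. ereal (norm (B *v z) / norm z)"
  let ?Z = "{z :: real ^ 'n. z \<noteq> 0}"
  define smax where "smax = (SUP z\<in>?Z. ?r z)"
  define smin where "smin = (INF z\<in>?Z. ?r z)"
  have x: "x \<in> ?Z" using Bx by auto
  then have e: "0 \<le> e"
    using order.trans[OF norm_ge_zero y] by (simp add: zero_le_mult_iff)
  have smin_le: "smin \<le> ?r z" if "z \<in> ?Z" for z
    unfolding smin_def using that by (rule INF_lower)
  have le_smax: "?r z \<le> smax" if "z \<in> ?Z" for z
    unfolding smax_def using that by (rule SUP_upper)
  \<comment> \<open>Both extremes are shown to be finite, so that their quotient can be computed in
    the reals.\<close>
  have "smax \<le> ereal (spectral_norm B)"
    unfolding smax_def
    by (rule SUP_least) (use norm_mult_le_spectral_norm in \<open>simp add: divide_le_eq\<close>)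
  then obtain S where S: "smax = ereal S"
    using le_smax[OF x] by (cases smax) auto
  have "0 \<le> smin"
    unfolding smin_def by (rule INF_greatest) simp
  then obtain m where m: "smin = ereal m" "0 \<le> m"
    using smin_le[OF x] by (cases smin) auto
  show ?thesis
  \<comment> \<open>\<open>B *v x \<noteq> 0\<close> for one \<open>x\<close> does not exclude a
    kernel of \<open>B\<close>, so the infimum may vanish.\<close>
  proof (cases "m = 0")
    case True
    then have "cond_number B = \<infinity>"
      using m unfolding cond_number_def smin_def by (simp add: Let_def)
    then show ?thesis
    proof (cases "e = 0")
      \<comment> \<open>here the right-hand side is the junk value \<open>\<infinity> * 0 = 0\<close>\<close>
      case True
      then have "y = 0" using y by simp
      moreover have "cond_number B * ereal e = 0"
        using True by (simp only: ereal_mult_zero flip: zero_ereal_def)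
      ultimately show ?thesis by (simp add: zero_ereal_def)
    next
      case False
      then show ?thesis using e \<open>cond_number B = \<infinity>\<close> by simp
    qed
  next
    case False
    then have m0: "0 < m" using m by simp
    then have cond: "cond_number B = ereal (S / m)"
      using S m(1) unfolding cond_number_def smin_def smax_def by (simp add: Let_def)
    have mx: "m * norm x \<le> norm (B *v x)"
      using smin_le[OF x] x m(1) by (simp add: le_divide_eq)
    have "0 \<le> ?r x"
      by simp
    also have "\<dots> \<le> ereal S"
      using le_smax[OF x] S by simp
    finally have S0: "0 \<le> S"
      by simp
    \<comment> \<open>The supremum ranges over nonzero vectors only, hence the separate case
      \<open>y = 0\<close>.\<close>
    have "norm (B *v y) \<le> S * norm y"
      using le_smax[of y] S by (cases "y = 0") (simp_all add: divide_le_eq)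
    also have "\<dots> \<le> S * (e * norm x)"
      using y S0 by (rule mult_left_mono)
    \<comment> \<open>Inserting \<open>m / m\<close> produces \<open>m * norm x\<close>, which
      \<open>mx\<close> bounds by \<open>norm (B *v x)\<close>.\<close>
    also have "\<dots> = S / m * e * (m * norm x)"
      using m0 by simp
    also have "\<dots> \<le> S / m * e * norm (B *v x)"
      using mx S0 e m0 by (intro mult_left_mono) auto
    finally show ?thesis
      using Bx by (simp add: cond divide_le_eq)
  qed
qed

theorem corollary4p2:
  fixes X :: "('s1::finite, 's2::finite, 's3::finite) tensor3"
    and A1 A1p dA1 A1new :: "real ^ 'r::finite ^ 's1"
    and A2 A2p dA2 A2new :: "real ^ 'r ^ 's2"
    and A3 A3p dA3 A3new \<delta>A3 :: "real ^ 'r ^ 's3"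
    and k :: 'r
    and \<epsilon> :: real
    and T :: "real ^ 's2 ^ 's1"
    and h h_pp :: "real ^ 's1"
  assumes "A1 = A1p + dA1" and "A2 = A2p + dA2" and "A3 = A3p + dA3"
    and "als_sweep X (A1, A2, A3) (A1new, A2new, A3new)"
    and "\<delta>A3 = A3new - A3"
    and "column k A1 \<noteq> 0" and "column k A2 \<noteq> 0" and "column k A3 \<noteq> 0"
    and "norm (column k dA1) / norm (column k A1) \<le> \<epsilon>"
    and "norm (column k dA2) / norm (column k A2) \<le> \<epsilon>"
    and "norm (column k dA3) / norm (column k A3) \<le> \<epsilon>"
    and "\<epsilon> < 1"
    and "T = contract3 X (column k \<delta>A3)"
    and "h = mttkrp_update13 (pp_operator13 X A2) \<delta>A3 k"
    and "h_pp = mttkrp_update13 (pp_operator13 X A2p) \<delta>A3 k"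
  shows "norm (h_pp - h) \<le> spectral_norm T * norm (column k A2) * \<epsilon>
    \<and> h = T *v column k A2
    \<and> (h \<noteq> 0 \<longrightarrow> ereal (norm (h_pp - h) / norm h) \<le> cond_number T * ereal \<epsilon>)"
proof (intro conjI impI)
  \<comment> \<open>The minus sign matches the vector to which \<open>T\<close> is applied in
    \<open>h_pp - h\<close>.\<close>
  have da: "norm (- column k dA2) \<le> \<epsilon> * norm (column k A2)"
    using assms(7,10) by (simp add: divide_le_eq)
  show hT: "h = T *v column k A2"
    by (simp add: assms(13,14) mttkrp_update13_pp_operator13)
  have "h_pp = T *v column k (A2 - dA2)"
    using assms(2) by (simp add: assms(13,15) mttkrp_update13_pp_operator13)
  then have diff: "h_pp - h = T *v (- column k dA2)"
    by (simp add: hT column_diff matrix_vector_mult_diff_distrib vec.neg)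
  have "norm (h_pp - h) \<le> spectral_norm T * norm (- column k dA2)"
    unfolding diff by (rule norm_mult_le_spectral_norm)
  also have "\<dots> \<le> spectral_norm T * (\<epsilon> * norm (column k A2))"
    using da spectral_norm_nonneg by (rule mult_left_mono)
  finally show "norm (h_pp - h) \<le> spectral_norm T * norm (column k A2) * \<epsilon>"
    by (simp add: mult_ac)
  assume "h \<noteq> 0"
  then have "T *v column k A2 \<noteq> 0"
    by (simp add: hT)
  \<comment> \<open>Here \<open>x\<close> is the current column and \<open>y\<close> its negated
    perturbation.\<close>
  from norm_quotient_le_cond_number[OF this da] show "ereal (norm (h_pp - h) / norm h) \<le> cond_number T * ereal \<epsilon>"
    by (simp only: diff flip: hT)
qed

end
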